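(* Let $F$ be a free group, let $H$ be a normal subgroup of $F$ such that the factor group $F/H$ is infinite, and let $S$ be a finite subset of $H$. Then the normal closure $N=\langle S\rangle^{H}$ of $S$ in $H$ contains no nontrivial normal subgroups of $F$.
   Context: For a group $G$ and a subset $S\subset G$, the normal closure $\langle S\rangle^{G}$ of $S$ in $G$ is the smallest normal subgroup of $G$ containing $S$. In the claim the closure is taken in $H$, i.e. $\langle S\rangle^H$ is the subgroup generated by all conjugates $hsh^{-1}$ with $h\in H$, $s\in S$. *)

theory Defs
  imports "HOL-Algebra.Generated_Groups"
begin

section \<open>Free groups\<close>

text \<open>
  A word over \<open>X\<close> is a list of letters; the letter \<open>(x, True)\<close> stands for \<open>x\<close> and
  \<open>(x, False)\<close> for the formal inverse of \<open>x\<close>.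
\<close>

definition reduced :: "('a \<times> bool) list \<Rightarrow> bool" where
  "reduced w \<longleftrightarrow> successively (\<lambda>a b. \<not> (fst a = fst b \<and> snd a \<noteq> snd b)) w"

definition reduced_words :: "'a set \<Rightarrow> ('a \<times> bool) list set" where
  "reduced_words X = {w. set w \<subseteq> X \<times> UNIV \<and> reduced w}"

definition letter_val :: "('g, 'm) monoid_scheme \<Rightarrow> ('a \<Rightarrow> 'g) \<Rightarrow> 'a \<times> bool \<Rightarrow> 'g" where
  "letter_val G f a = (if snd a then f (fst a) else inv\<^bsub>G\<^esub> (f (fst a)))"

fun word_val :: "('g, 'm) monoid_scheme \<Rightarrow> ('a \<Rightarrow> 'g) \<Rightarrow> ('a \<times> bool) list \<Rightarrow> 'g" where
  "word_val G f [] = \<one>\<^bsub>G\<^esub>"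
| "word_val G f (a # w) = letter_val G f a \<otimes>\<^bsub>G\<^esub> word_val G f w"

text \<open>
  \<open>X\<close> is a free basis if every element of \<open>F\<close> is the value of exactly one reduced word
  over \<open>X\<close>. The usual universal property quantifies over groups of arbitrary type, so it cannot
  serve as the definition in HOL; it is derived below. There is no restriction on the rank: \<open>X\<close> may be
  empty or infinite.
\<close>

definition free_basis :: "('a, 'm) monoid_scheme \<Rightarrow> 'a set \<Rightarrow> bool" where
  "free_basis F X \<longleftrightarrow>
     X \<subseteq> carrier F \<and> bij_betw (word_val F (\<lambda>x. x)) (reduced_words X) (carrier F)"

definition free_group :: "('a, 'm) monoid_scheme \<Rightarrow> bool" where
  "free_group F \<longleftrightarrow> group F \<and> (\<exists>X. free_basis F X)"

section \<open>Normal closures\<close>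

text \<open>The smallest normal subgroup of \<open>G\<close> containing \<open>S\<close>; meaningful for \<open>S \<subseteq> carrier G\<close>.\<close>

definition normal_closure :: "('a, 'm) monoid_scheme \<Rightarrow> 'a set \<Rightarrow> 'a set" where
  "normal_closure G S = \<Inter> {N. N \<lhd> G \<and> S \<subseteq> N}"

lemma (in group) conjugates_generate_normal:
  assumes S: "S \<subseteq> carrier G"
  shows "generate G {h \<otimes> s \<otimes> inv h | h s. h \<in> carrier G \<and> s \<in> S} \<lhd> G"
proof (rule normal_generateI)
  show "{h \<otimes> s \<otimes> inv h | h s. h \<in> carrier G \<and> s \<in> S} \<subseteq> carrier G"
    using S by auto
next
  fix g c
  assume "c \<in> {h \<otimes> s \<otimes> inv h | h s. h \<in> carrier G \<and> s \<in> S}" and g: "g \<in> carrier G"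
  then obtain h s where h: "h \<in> carrier G" and s: "s \<in> S" and c: "c = h \<otimes> s \<otimes> inv h"
    by blast
  have "g \<otimes> c \<otimes> inv g = (g \<otimes> h) \<otimes> s \<otimes> inv (g \<otimes> h)"
    using g h s S by (simp add: c m_assoc inv_mult_group subset_iff)
  then show "g \<otimes> c \<otimes> inv g \<in> {h \<otimes> s \<otimes> inv h | h s. h \<in> carrier G \<and> s \<in> S}"
    using g h s by blast
qed

lemma (in group) normal_closure_eq_generate:
  assumes S: "S \<subseteq> carrier G"
  shows "normal_closure G S = generate G {h \<otimes> s \<otimes> inv h | h s. h \<in> carrier G \<and> s \<in> S}"
    (is "_ = generate G ?C")
proof
  have "S \<subseteq> ?C"
  proof
    fix s assume "s \<in> S"
    with S have "s = \<one> \<otimes> s \<otimes> inv \<one>" by auto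
    with \<open>s \<in> S\<close> show "s \<in> ?C" by blast
  qed
  then have "S \<subseteq> generate G ?C" by (meson generate.incl subset_iff)
  then show "normal_closure G S \<subseteq> generate G ?C"
    using conjugates_generate_normal[OF S] by (auto simp: normal_closure_def)
next
  show "generate G ?C \<subseteq> normal_closure G S"
    unfolding normal_closure_def
  proof (rule Inter_greatest, clarify)
    fix N x assume N: "N \<lhd> G" "S \<subseteq> N" and x: "x \<in> generate G ?C"
    have "?C \<subseteq> N" using N normal_inv_iff by auto
    moreover have "subgroup N G" using N normal_inv_iff by auto
    ultimately show "x \<in> N" using generate_subgroup_incl x by blast
  qed
qed

lemma (in group) normal_closure_normal:
  "S \<subseteq> carrier G \<Longrightarrow> normal_closure G S \<lhd> G"
  using conjugates_generate_normal normal_closure_eq_generate by simp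

lemma normal_closure_superset: "S \<subseteq> normal_closure G S"
  by (auto simp: normal_closure_def)

lemma normal_closure_least: "N \<lhd> G \<Longrightarrow> S \<subseteq> N \<Longrightarrow> normal_closure G S \<subseteq> N"
  by (auto simp: normal_closure_def)

section \<open>The universal property of a free basis\<close>

fun cancel_cons :: "'a \<times> bool \<Rightarrow> ('a \<times> bool) list \<Rightarrow> ('a \<times> bool) list" where
  "cancel_cons a [] = [a]"
| "cancel_cons a (b # w) = (if fst a = fst b \<and> snd a \<noteq> snd b then w else a # b # w)"

definition reduce :: "('a \<times> bool) list \<Rightarrow> ('a \<times> bool) list" where
  "reduce w = foldr cancel_cons w []"

lemma reduce_reduced_words:
  "set w \<subseteq> X \<times> UNIV \<Longrightarrow> reduce w \<in> reduced_words X"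
proof (induction w)
  case Nil
  then show ?case by (simp add: reduce_def reduced_words_def reduced_def)
next
  case (Cons a w)
  then have "reduce w \<in> reduced_words X" and "a \<in> X \<times> UNIV" by auto
  then have "cancel_cons a (reduce w) \<in> reduced_words X"
    by (cases "reduce w")
      (auto simp: reduced_words_def reduced_def successively_Cons)
  then show ?case by (simp add: reduce_def)
qed

lemma (in group) letter_val_closed:
  "f \<in> X \<rightarrow> carrier G \<Longrightarrow> a \<in> X \<times> UNIV \<Longrightarrow> letter_val G f a \<in> carrier G"
  by (auto simp: letter_val_def)

lemma (in group) word_val_closed:
  "f \<in> X \<rightarrow> carrier G \<Longrightarrow> set w \<subseteq> X \<times> UNIV \<Longrightarrow> word_val G f w \<in> carrier G"
proof (induction w)
  case (Cons a w)
  then show ?case using letter_val_closed[of f X a] by simp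
qed simp

lemma (in group) word_val_append:
  assumes "f \<in> X \<rightarrow> carrier G" "set v \<subseteq> X \<times> UNIV" "set w \<subseteq> X \<times> UNIV"
  shows "word_val G f (v @ w) = word_val G f v \<otimes> word_val G f w"
  using assms
proof (induction v)
  case Nil
  then show ?case using word_val_closed[of f X w] by simp
next
  case (Cons a v)
  then show ?case
    using letter_val_closed[of f X a] word_val_closed[of f X v] word_val_closed[of f X w]
    by (simp add: m_assoc)
qed

lemma (in group) word_val_cancel_cons:
  assumes f: "f \<in> X \<rightarrow> carrier G" and a: "a \<in> X \<times> UNIV" and w: "set w \<subseteq> X \<times> UNIV"
  shows "word_val G f (cancel_cons a w) = letter_val G f a \<otimes> word_val G f w"
proof (cases w)
  case (Cons b v)
  show ?thesis
  proof (cases "fst a = fst b \<and> snd a \<noteq> snd b")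
    case True
    have fa: "f (fst a) \<in> carrier G" using f a by auto
    have v: "word_val G f v \<in> carrier G" using word_val_closed[OF f] w Cons by auto
    have "letter_val G f a \<otimes> letter_val G f b = \<one>"
      using True fa by (auto simp: letter_val_def)
    then have "letter_val G f a \<otimes> (letter_val G f b \<otimes> word_val G f v) = word_val G f v"
      using letter_val_closed[OF f] a w Cons v by (metis l_one list.set_intros(1) m_assoc subset_iff)
    then show ?thesis using True Cons by simp
  qed (auto simp: Cons)
qed simp

lemma (in group) word_val_reduce:
  assumes f: "f \<in> X \<rightarrow> carrier G" and w: "set w \<subseteq> X \<times> UNIV"
  shows "word_val G f (reduce w) = word_val G f w"
  using w
proof (induction w)
  case (Cons a w)
  moreover have "set (reduce w) \<subseteq> X \<times> UNIV"
    using reduce_reduced_words[of w X] Cons.prems by (auto simp: reduced_words_def)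
  ultimately show ?case
    using word_val_cancel_cons[OF f, of a "reduce w"] by (simp add: reduce_def)
qed (simp add: reduce_def)

lemma (in group_hom) hom_word_val:
  assumes f: "f \<in> X \<rightarrow> carrier G" and w: "set w \<subseteq> X \<times> UNIV"
  shows "h (word_val G f w) = word_val H (\<lambda>x. h (f x)) w"
  using w
proof (induction w)
  case (Cons a w)
  then have "word_val G f w \<in> carrier G" "letter_val G f a \<in> carrier G" "f (fst a) \<in> carrier G"
    using G.word_val_closed[OF f] G.letter_val_closed[OF f] f by auto
  then show ?case using Cons by (auto simp: letter_val_def)
qed simp

lemma word_val_cong:
  "(\<And>x. x \<in> X \<Longrightarrow> f x = g x) \<Longrightarrow> set w \<subseteq> X \<times> UNIV \<Longrightarrow> word_val G f w = word_val G g w"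
  by (induction w) (auto simp: letter_val_def)

theorem free_basis_universal:
  assumes "group F" "free_basis F X" "group G" and f: "f \<in> X \<rightarrow> carrier G"
  shows "\<exists>h \<in> hom F G. (\<forall>x \<in> X. h x = f x) \<and>
           (\<forall>k \<in> hom F G. (\<forall>x \<in> X. k x = f x) \<longrightarrow> (\<forall>g \<in> carrier F. k g = h g))"
proof -
  interpret F: group F by fact
  interpret G: group G by fact
  let ?val = "word_val F (\<lambda>x. x)"
  define nf where "nf = inv_into (reduced_words X) ?val"
  define h where "h = (\<lambda>g. word_val G f (nf g))"
  have X: "(\<lambda>x. x) \<in> X \<rightarrow> carrier F" and bij: "bij_betw ?val (reduced_words X) (carrier F)"
    using assms(2) by (auto simp: free_basis_def)
  have nf: "set (nf g) \<subseteq> X \<times> UNIV" "?val (nf g) = g" if "g \<in> carrier F" for g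
  proof -
    have "nf g \<in> reduced_words X"
      using bij that unfolding nf_def bij_betw_def by (metis inv_into_into)
    then show "set (nf g) \<subseteq> X \<times> UNIV" by (simp add: reduced_words_def)
    show "?val (nf g) = g"
      using bij that unfolding nf_def bij_betw_def by (metis f_inv_into_f)
  qed
  have h_val: "h (?val w) = word_val G f w" if w: "set w \<subseteq> X \<times> UNIV" for w
  proof -
    have "nf (?val w) = reduce w"
      using bij reduce_reduced_words[OF w] F.word_val_reduce[OF X w]
      unfolding nf_def bij_betw_def by (metis inv_into_f_f)
    then show ?thesis using G.word_val_reduce[OF f w] by (simp add: h_def)
  qed
  have h_hom: "h \<in> hom F G"
  proof (rule homI)
    fix a b assume a: "a \<in> carrier F" and b: "b \<in> carrier F"
    show "h a \<in> carrier G" using G.word_val_closed[OF f nf(1)[OF a]] by (simp add: h_def)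
    have "h (a \<otimes>\<^bsub>F\<^esub> b) = h (?val (nf a @ nf b))"
      using F.word_val_append[OF X nf(1)[OF a] nf(1)[OF b]] nf(2) a b by simp
    also have "\<dots> = h a \<otimes>\<^bsub>G\<^esub> h b"
      using h_val[of "nf a @ nf b"] nf(1)[OF a] nf(1)[OF b]
        G.word_val_append[OF f nf(1)[OF a] nf(1)[OF b]] by (simp add: h_def)
    finally show "h (a \<otimes>\<^bsub>F\<^esub> b) = h a \<otimes>\<^bsub>G\<^esub> h b" .
  qed
  have h_X: "h x = f x" if x: "x \<in> X" for x
  proof -
    have "x \<in> carrier F" "f x \<in> carrier G" using X f x by auto
    then show ?thesis using h_val[of "[(x, True)]"] x by (simp add: letter_val_def)
  qed
  have uniq: "k g = h g"
    if k: "k \<in> hom F G" and kX: "\<forall>x \<in> X. k x = f x" and g: "g \<in> carrier F" for k g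
  proof -
    interpret k: group_hom F G k
      using k by (simp add: group_hom_def group_hom_axioms_def assms(1,3))
    have "k g = word_val G k (nf g)"
      using k.hom_word_val[OF X nf(1)[OF g]] nf(2)[OF g] by simp
    also have "\<dots> = h g"
      unfolding h_def using kX nf(1)[OF g] by (intro word_val_cong[of X]) auto
    finally show ?thesis .
  qed
  show ?thesis using h_hom h_X uniq by blast
qed

end

theory Submission
  imports Defs
begin

text \<open>
  Write \<open>Q = F/H\<close>, let \<open>X\<close> be a free basis of \<open>F\<close>, and think of an element of \<open>F\<close> as a word that is
  walked, starting at a vertex \<open>v\<close>, in the Cayley graph of \<open>Q\<close> with respect to the image of \<open>X\<close>.
  Elements of \<open>H\<close> are the words that walk along closed paths. A letter \<open>x\<close> read at a vertex \<open>u\<close>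
  runs through the edge from \<open>u\<close> to \<open>xu\<close>, and its inverse runs through the same edge backwards. The
  walks of the finitely many words in \<open>S\<close> from the vertex \<open>1\<close> visit only a finite set \<open>B\<close> of vertices.
  Let \<open>\<psi> w v\<close> be what remains of the word \<open>w\<close>, as an element of \<open>F\<close>, when in its walk from \<open>v\<close> all
  letters are deleted whose edge begins in \<open>B\<close>. This does not depend on the word chosen for \<open>w\<close>,
  since a letter and its inverse next to each other run through the same edge and are deleted or
  kept together.

  Walks that start at \<open>1\<close> and are closed can be concatenated, so \<open>w \<mapsto> \<psi> w 1\<close> is a homomorphism on
  \<open>H\<close>. It kills \<open>S\<close>, and hence the normal closure \<open>N\<close> of \<open>S\<close> in \<open>H\<close>. Now let \<open>r\<close> lie in a normal
  subgroup of \<open>F\<close> contained in \<open>N\<close>. As \<open>Q\<close> is infinite, some vertex \<open>v\<close>, say the class of \<open>f\<close>, is so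
  far away that the walk of \<open>r\<close> from \<open>v\<close> misses \<open>B\<close>; therefore \<open>\<psi> r v = r\<close>. The conjugate
  \<open>n = f\<^sup>-\<^sup>1 r f\<close> also lies in \<open>N\<close>, so \<open>\<psi> n 1 = 1\<close>. Comparing the two ways to walk along \<open>r f = f n\<close>
  from \<open>1\<close> gives \<open>r (\<psi> f 1) = \<psi> f 1\<close>, that is, \<open>r = 1\<close>.

  The functions \<open>\<psi>\<close> are crossed homomorphisms. Their existence (\<open>crossed_hom_extends\<close>) is the
  universal property of \<open>F\<close> applied to a wreath product, as in the Magnus embedding, and
  \<open>trail_exists\<close> captures that a walk visits only finitely many vertices.
\<close>

section \<open>Crossed homomorphisms on a free group\<close>

text \<open>
  Elements of \<open>Q\<close> act on functions \<open>Q \<rightarrow> A\<close> by translation, and a word is read from right to left: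
  the right factor \<open>w\<close> is walked first and moves the vertex from \<open>v\<close> to \<open>q w \<otimes> v\<close>.
\<close>

definition crossed_hom ::
  "('a, 'm) monoid_scheme \<Rightarrow> ('q, 'n) monoid_scheme \<Rightarrow> ('b, 'k) monoid_scheme \<Rightarrow>
     ('a \<Rightarrow> 'q) \<Rightarrow> ('a \<Rightarrow> 'q \<Rightarrow> 'b) \<Rightarrow> bool" where
  "crossed_hom F Q A q \<psi> \<longleftrightarrow>
     (\<forall>u \<in> carrier F. \<forall>v \<in> carrier Q. \<psi> u v \<in> carrier A) \<and>
     (\<forall>u \<in> carrier F. \<forall>w \<in> carrier F. \<forall>v \<in> carrier Q.
        \<psi> (u \<otimes>\<^bsub>F\<^esub> w) v = \<psi> u (q w \<otimes>\<^bsub>Q\<^esub> v) \<otimes>\<^bsub>A\<^esub> \<psi> w v)"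

lemma crossed_hom_closed:
  "crossed_hom F Q A q \<psi> \<Longrightarrow> u \<in> carrier F \<Longrightarrow> v \<in> carrier Q \<Longrightarrow> \<psi> u v \<in> carrier A"
  by (simp add: crossed_hom_def)

lemma crossed_hom_mult:
  "crossed_hom F Q A q \<psi> \<Longrightarrow> u \<in> carrier F \<Longrightarrow> w \<in> carrier F \<Longrightarrow> v \<in> carrier Q \<Longrightarrow>
     \<psi> (u \<otimes>\<^bsub>F\<^esub> w) v = \<psi> u (q w \<otimes>\<^bsub>Q\<^esub> v) \<otimes>\<^bsub>A\<^esub> \<psi> w v"
  by (simp add: crossed_hom_def)

lemma crossed_hom_one:
  assumes "group A" and q: "group_hom F Q q" and \<psi>: "crossed_hom F Q A q \<psi>"
    and v: "v \<in> carrier Q"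
  shows "\<psi> \<one>\<^bsub>F\<^esub> v = \<one>\<^bsub>A\<^esub>"
proof -
  interpret A: group A by fact
  interpret q: group_hom F Q q by fact
  have "\<psi> \<one>\<^bsub>F\<^esub> v \<otimes>\<^bsub>A\<^esub> \<psi> \<one>\<^bsub>F\<^esub> v = \<psi> \<one>\<^bsub>F\<^esub> v"
    using crossed_hom_mult[OF \<psi> q.G.one_closed q.G.one_closed v] v by simp
  then show ?thesis using crossed_hom_closed[OF \<psi> q.G.one_closed v] by simp
qed

lemma crossed_hom_inv:
  assumes "group A" and q: "group_hom F Q q" and \<psi>: "crossed_hom F Q A q \<psi>"
    and u: "u \<in> carrier F" and v: "v \<in> carrier Q"
  shows "\<psi> (inv\<^bsub>F\<^esub> u) v = inv\<^bsub>A\<^esub> \<psi> u (q (inv\<^bsub>F\<^esub> u) \<otimes>\<^bsub>Q\<^esub> v)"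
proof -
  interpret A: group A by fact
  interpret q: group_hom F Q q by fact
  have v': "q (inv\<^bsub>F\<^esub> u) \<otimes>\<^bsub>Q\<^esub> v \<in> carrier Q" using u v by simp
  have "\<psi> u (q (inv\<^bsub>F\<^esub> u) \<otimes>\<^bsub>Q\<^esub> v) \<otimes>\<^bsub>A\<^esub> \<psi> (inv\<^bsub>F\<^esub> u) v = \<one>\<^bsub>A\<^esub>"
    using crossed_hom_mult[OF \<psi> u q.G.inv_closed[OF u] v] u
      crossed_hom_one[OF assms(1-3) v] by simp
  then show ?thesis
    using A.inv_equality A.inv_inv crossed_hom_closed[OF \<psi>] u v v' q.G.inv_closed
    by (metis A.inv_comm)
qed

text \<open>
  The unrestricted wreath product of \<open>A\<close> and \<open>Q\<close>. Functions are extensional so that the group laws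
  are equations.
\<close>

definition wreath ::
  "('q, 'n) monoid_scheme \<Rightarrow> ('b, 'k) monoid_scheme \<Rightarrow> (('q \<Rightarrow> 'b) \<times> 'q) monoid" where
  "wreath Q A =
     \<lparr>carrier = (carrier Q \<rightarrow>\<^sub>E carrier A) \<times> carrier Q,
      mult = (\<lambda>(p, u) (r, w).
        (\<lambda>v \<in> carrier Q. p (w \<otimes>\<^bsub>Q\<^esub> v) \<otimes>\<^bsub>A\<^esub> r v, u \<otimes>\<^bsub>Q\<^esub> w)),
      one = (\<lambda>v \<in> carrier Q. \<one>\<^bsub>A\<^esub>, \<one>\<^bsub>Q\<^esub>)\<rparr>"

lemma wreath_group:
  assumes "group Q" "group A"
  shows "group (wreath Q A)"
proof -
  interpret Q: group Q by fact
  interpret A: group A by fact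
  show ?thesis
  proof (rule groupI)
    fix x y assume "x \<in> carrier (wreath Q A)" "y \<in> carrier (wreath Q A)"
    then show "x \<otimes>\<^bsub>wreath Q A\<^esub> y \<in> carrier (wreath Q A)"
      by (auto simp: wreath_def split_beta PiE_iff)
  next
    show "\<one>\<^bsub>wreath Q A\<^esub> \<in> carrier (wreath Q A)"
      by (auto simp: wreath_def)
  next
    fix x y z
    assume "x \<in> carrier (wreath Q A)" "y \<in> carrier (wreath Q A)" "z \<in> carrier (wreath Q A)"
    then show "x \<otimes>\<^bsub>wreath Q A\<^esub> y \<otimes>\<^bsub>wreath Q A\<^esub> z =
        x \<otimes>\<^bsub>wreath Q A\<^esub> (y \<otimes>\<^bsub>wreath Q A\<^esub> z)"
      by (auto simp: wreath_def split_beta PiE_iff Q.m_assoc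
          intro!: restrict_ext A.m_assoc)
  next
    fix x assume "x \<in> carrier (wreath Q A)"
    then show "\<one>\<^bsub>wreath Q A\<^esub> \<otimes>\<^bsub>wreath Q A\<^esub> x = x"
      by (auto simp: wreath_def split_beta PiE_iff fun_eq_iff extensional_def)
  next
    fix x assume x: "x \<in> carrier (wreath Q A)"
    obtain p u where xe: "x = (p, u)" by (cases x)
    have p: "p \<in> carrier Q \<rightarrow>\<^sub>E carrier A" and u: "u \<in> carrier Q"
      using x by (auto simp: wreath_def xe)
    let ?y = "(\<lambda>v \<in> carrier Q. inv\<^bsub>A\<^esub> p (inv\<^bsub>Q\<^esub> u \<otimes>\<^bsub>Q\<^esub> v), inv\<^bsub>Q\<^esub> u)"
    have "?y \<in> carrier (wreath Q A)"
      using p u by (auto simp: wreath_def PiE_iff)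
    moreover have "?y \<otimes>\<^bsub>wreath Q A\<^esub> x = \<one>\<^bsub>wreath Q A\<^esub>"
      using p u by (auto simp: wreath_def xe PiE_iff Q.m_assoc[symmetric] intro!: restrict_ext)
    ultimately show "\<exists>y \<in> carrier (wreath Q A). y \<otimes>\<^bsub>wreath Q A\<^esub> x = \<one>\<^bsub>wreath Q A\<^esub>"
      by blast
  qed
qed

text \<open>
  A crossed homomorphism over \<open>q\<close> is the first component of a homomorphism into the wreath product
  whose second component is \<open>q\<close>, so the universal property lets its values on a basis be prescribed
  at will.
\<close>

lemma crossed_hom_extends:
  assumes "free_basis F X" and "group A" and q: "group_hom F Q q"
    and c: "\<And>x v. x \<in> X \<Longrightarrow> v \<in> carrier Q \<Longrightarrow> c x v \<in> carrier A"
  obtains \<psi> where "crossed_hom F Q A q \<psi>"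
    and "\<And>x v. x \<in> X \<Longrightarrow> v \<in> carrier Q \<Longrightarrow> \<psi> x v = c x v"
proof -
  interpret q: group_hom F Q q by fact
  interpret A: group A by fact
  let ?W = "wreath Q A"
  have X: "X \<subseteq> carrier F" using assms(1) by (simp add: free_basis_def)
  have "(\<lambda>x. (\<lambda>v \<in> carrier Q. c x v, q x)) \<in> X \<rightarrow> carrier ?W"
    using c X by (auto simp: wreath_def)
  note free_basis_universal[OF q.G.is_group assms(1) wreath_group[OF q.H.is_group assms(2)] this]
  then obtain h where h: "h \<in> hom F ?W"
    and hX: "\<And>x. x \<in> X \<Longrightarrow> h x = (\<lambda>v \<in> carrier Q. c x v, q x)"
    by (elim bexE conjE) simp
  have hc: "h u \<in> carrier ?W" if "u \<in> carrier F" for u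
    using h that by (auto simp: hom_def)
  have hm: "h (u \<otimes>\<^bsub>F\<^esub> w) = h u \<otimes>\<^bsub>?W\<^esub> h w" if "u \<in> carrier F" "w \<in> carrier F" for u w
    using h that by (auto simp: hom_def)
  have snd_h: "snd (h u) = q u" if "u \<in> carrier F" for u
  proof -
    have "q \<in> X \<rightarrow> carrier Q" using X by auto
    note free_basis_universal[OF q.G.is_group assms(1) q.H.is_group this]
    then obtain k where k: "\<forall>g \<in> hom F Q. (\<forall>x \<in> X. g x = q x) \<longrightarrow> (\<forall>u \<in> carrier F. g u = k u)"
      by (elim bexE conjE) rule
    have "(\<lambda>u. snd (h u)) \<in> hom F Q"
      using hc by (intro homI) (simp_all add: hm wreath_def split_beta mem_Times_iff)
    from bspec[OF k this] have "snd (h u) = k u" using hX that by simp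
    also have "k u = q u" using bspec[OF k q.homh] that by simp
    finally show ?thesis .
  qed
  show thesis
  proof (rule that[of "\<lambda>u. fst (h u)"])
    show "crossed_hom F Q A q (\<lambda>u. fst (h u))"
      unfolding crossed_hom_def
    proof (intro conjI ballI)
      fix u v assume "u \<in> carrier F" "v \<in> carrier Q"
      then show "fst (h u) v \<in> carrier A" using hc[of u] by (auto simp: wreath_def mem_Times_iff)
    next
      fix u w v assume "u \<in> carrier F" "w \<in> carrier F" "v \<in> carrier Q"
      then show "fst (h (u \<otimes>\<^bsub>F\<^esub> w)) v =
          fst (h u) (q w \<otimes>\<^bsub>Q\<^esub> v) \<otimes>\<^bsub>A\<^esub> fst (h w) v"
        using hm[of u w] snd_h[of w] by (simp add: wreath_def split_beta)
    qed
  next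
    fix x v assume "x \<in> X" "v \<in> carrier Q"
    then show "fst (h x) v = c x v" using hX by simp
  qed
qed

text \<open>
  If \<open>D\<close> contains the vertices that the walk of a word for \<open>w\<close> from \<open>1\<close> visits, then the walk from \<open>v\<close>
  stays in the translate of \<open>D\<close> by \<open>v\<close>. So if a crossed homomorphism \<open>\<psi>\<close> treats the basis elements
  there as a homomorphism \<open>\<theta>\<close> does, then the two agree on \<open>w\<close>; this consequence is the definition.
  The set must serve all \<open>\<psi>\<close>, because \<open>\<psi>\<close> will be built from such sets. It is used for two choices
  of \<open>\<theta>\<close>: the trivial homomorphism where all letters are deleted, and the identity where all
  letters are kept.
\<close>

definition trail ::
  "('a, 'm) monoid_scheme \<Rightarrow> 'a set \<Rightarrow> ('q, 'n) monoid_scheme \<Rightarrow> ('b, 'k) monoid_scheme \<Rightarrow>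
     ('a \<Rightarrow> 'q) \<Rightarrow> 'a \<Rightarrow> 'q set \<Rightarrow> bool" where
  "trail F X Q A q w D \<longleftrightarrow>
     finite D \<and> D \<subseteq> carrier Q \<and>
     (\<forall>\<psi> \<theta> v. crossed_hom F Q A q \<psi> \<longrightarrow> \<theta> \<in> hom F A \<longrightarrow> v \<in> carrier Q \<longrightarrow>
        (\<forall>d \<in> D. \<forall>x \<in> X. \<psi> x (d \<otimes>\<^bsub>Q\<^esub> v) = \<theta> x) \<longrightarrow> \<psi> w v = \<theta> w)"

lemma trail_agree:
  assumes "trail F X Q A q w D" "crossed_hom F Q A q \<psi>" "\<theta> \<in> hom F A" "v \<in> carrier Q"
    and "\<And>d x. d \<in> D \<Longrightarrow> x \<in> X \<Longrightarrow> \<psi> x (d \<otimes>\<^bsub>Q\<^esub> v) = \<theta> x"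
  shows "\<psi> w v = \<theta> w"
  using assms by (simp add: trail_def)

text \<open>A word has only finitely many letters, so its walk visits only finitely many vertices.\<close>

lemma trail_exists:
  assumes "free_basis F X" and "group A" and q: "group_hom F Q q"
    and w: "w \<in> carrier F"
  shows "\<exists>D. trail F X Q A q w D"
proof -
  interpret q: group_hom F Q q by fact
  interpret A: group A by fact
  let ?val = "word_val F (\<lambda>x. x)"
  have X: "(\<lambda>x. x) \<in> X \<rightarrow> carrier F" using assms(1) by (auto simp: free_basis_def)
  have ex: "\<exists>D. trail F X Q A q (?val l) D" if "set l \<subseteq> X \<times> UNIV" for l
    using that
  proof (induction l)
    case Nil
    have "trail F X Q A q \<one>\<^bsub>F\<^esub> {}"
      using crossed_hom_one[OF assms(2) q] q.G.is_group
      by (auto simp: trail_def hom_one[OF _ q.G.is_group assms(2)])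
    then show ?case by auto
  next
    case (Cons a l)
    let ?w = "?val l" and ?a = "letter_val F (\<lambda>x. x) a"
    have w: "?w \<in> carrier F" and a: "?a \<in> carrier F" and xX: "fst a \<in> X"
      and x: "fst a \<in> carrier F"
      using q.G.word_val_closed[OF X] q.G.letter_val_closed[OF X] X Cons.prems by auto
    obtain D where D: "trail F X Q A q ?w D" using Cons by auto
    \<comment> \<open>A letter \<open>x\<close> is recorded at the vertex where its edge begins. This is where the walk stands
      before reading \<open>x\<close>, but where it stands after reading the inverse of \<open>x\<close>; both are added.\<close>
    have "trail F X Q A q (?a \<otimes>\<^bsub>F\<^esub> ?w) (insert (q ?w) (insert (q ?a \<otimes>\<^bsub>Q\<^esub> q ?w) D))"
    proof (unfold trail_def, intro conjI allI impI)
      show "finite (insert (q ?w) (insert (q ?a \<otimes>\<^bsub>Q\<^esub> q ?w) D))"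
        and "insert (q ?w) (insert (q ?a \<otimes>\<^bsub>Q\<^esub> q ?w) D) \<subseteq> carrier Q"
        using D w a by (auto simp: trail_def)
    next
      fix \<psi> \<theta> v
      assume \<psi>: "crossed_hom F Q A q \<psi>" and \<theta>: "\<theta> \<in> hom F A" and v: "v \<in> carrier Q"
        and eq: "\<forall>d \<in> insert (q ?w) (insert (q ?a \<otimes>\<^bsub>Q\<^esub> q ?w) D).
          \<forall>x \<in> X. \<psi> x (d \<otimes>\<^bsub>Q\<^esub> v) = \<theta> x"
      interpret \<theta>: group_hom F A \<theta>
        using \<theta> by unfold_locales
      have "\<psi> ?w v = \<theta> ?w" using trail_agree[OF D \<psi> \<theta> v] eq by simp
      moreover have "\<psi> ?a (q ?w \<otimes>\<^bsub>Q\<^esub> v) = \<theta> ?a"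
      proof (cases "snd a")
        case True
        then show ?thesis using eq xX by (simp add: letter_val_def)
      next
        case False
        then have ai: "?a = inv\<^bsub>F\<^esub> fst a" by (simp add: letter_val_def)
        have "\<psi> (fst a) (q ?a \<otimes>\<^bsub>Q\<^esub> (q ?w \<otimes>\<^bsub>Q\<^esub> v)) = \<theta> (fst a)"
          using eq xX w a v by (simp add: q.H.m_assoc)
        then show ?thesis
          using crossed_hom_inv[OF assms(2) q \<psi> x, of "q ?w \<otimes>\<^bsub>Q\<^esub> v"] w v x
          by (simp add: ai)
      qed
      ultimately show "\<psi> (?a \<otimes>\<^bsub>F\<^esub> ?w) v = \<theta> (?a \<otimes>\<^bsub>F\<^esub> ?w)"
        using crossed_hom_mult[OF \<psi> a w v] a w by simp
    qed
    then show ?case by auto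
  qed
  have "w \<in> ?val ` reduced_words X"
    using assms(1) w by (simp add: free_basis_def bij_betw_def)
  then obtain l where "w = ?val l" and "l \<in> reduced_words X" by (rule imageE)
  with ex show ?thesis by (simp add: reduced_words_def)
qed

section \<open>Normal closures in a normal subgroup of infinite index\<close>

text \<open>
  On the kernel \<open>H\<close> of \<open>q\<close> walks starting at \<open>1\<close> end at \<open>1\<close>, so a crossed homomorphism restricts to
  a genuine one, with a normal kernel.
\<close>

lemma crossed_hom_kernel_normal:
  assumes "group A" and q: "group_hom F Q q" and \<psi>: "crossed_hom F Q A q \<psi>"
    and H: "subgroup H F" and qH: "\<And>h. h \<in> H \<Longrightarrow> q h = \<one>\<^bsub>Q\<^esub>"
  shows "{h \<in> H. \<psi> h \<one>\<^bsub>Q\<^esub> = \<one>\<^bsub>A\<^esub>} \<lhd> F\<lparr>carrier := H\<rparr>"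
proof -
  interpret q: group_hom F Q q by fact
  interpret A: group A by fact
  have HF: "h \<in> carrier F" if "h \<in> H" for h using subgroup.subset[OF H] that by blast
  have "(\<lambda>h. \<psi> h \<one>\<^bsub>Q\<^esub>) \<in> hom (F\<lparr>carrier := H\<rparr>) A"
    using crossed_hom_closed[OF \<psi>] crossed_hom_mult[OF \<psi>] HF qH by (intro homI) auto
  then interpret \<psi>: group_hom "F\<lparr>carrier := H\<rparr>" A "\<lambda>h. \<psi> h \<one>\<^bsub>Q\<^esub>"
    using q.G.subgroup_imp_group[OF H] assms(1)
    by (simp add: group_hom_def group_hom_axioms_def)
  show ?thesis using \<psi>.normal_kernel by (simp add: kernel_def)
qed

text \<open>Each of the finitely many pairs \<open>(d, b)\<close> rules out only the translation by \<open>inv d \<otimes> b\<close>.\<close>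

lemma (in group) translate_disjoint:
  assumes "infinite (carrier G)" "finite D" "finite B" "D \<subseteq> carrier G" "B \<subseteq> carrier G"
  obtains v where "v \<in> carrier G" and "\<And>d. d \<in> D \<Longrightarrow> d \<otimes> v \<notin> B"
proof -
  have "finite ((\<lambda>(d, b). inv d \<otimes> b) ` (D \<times> B))" using assms by simp
  then obtain v where v: "v \<in> carrier G" "v \<notin> (\<lambda>(d, b). inv d \<otimes> b) ` (D \<times> B)"
    using assms(1) by (meson finite_subset subsetI)
  have "d \<otimes> v \<notin> B" if "d \<in> D" for d
  proof
    assume "d \<otimes> v \<in> B"
    moreover have "v = inv d \<otimes> (d \<otimes> v)"
      using v(1) that assms(4) by (simp add: m_assoc[symmetric] subset_iff)
    ultimately show False using v(2) that by force
  qed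
  with v(1) show thesis by (rule that)
qed

theorem theorem1p1:
  fixes F :: "('a, 'm) monoid_scheme" and H S :: "'a set"
  assumes "free_group F"
    and "H \<lhd> F"
    and "infinite (carrier (F Mod H))"
    and "finite S"
    and "S \<subseteq> H"
  shows "\<forall>K. K \<lhd> F \<and> K \<subseteq> normal_closure (F\<lparr>carrier := H\<rparr>) S \<longrightarrow> K = {\<one>\<^bsub>F\<^esub>}"
proof (intro allI impI)
  fix K assume K: "K \<lhd> F \<and> K \<subseteq> normal_closure (F\<lparr>carrier := H\<rparr>) S"
  obtain X where F: "group F" and X: "free_basis F X"
    using assms(1) by (auto simp: free_group_def)
  interpret F: group F by fact
  interpret H: normal H F by fact
  interpret K: normal K F using K by simp
  let ?Q = "F Mod H"
  define q where "q = (\<lambda>u. H #>\<^bsub>F\<^esub> u)"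
  have Q: "group ?Q" by (rule H.factorgroup_is_group)
  interpret Q: group ?Q by fact
  have q: "group_hom F ?Q q"
    using H.r_coset_hom_Mod F Q by (simp add: q_def group_hom_def group_hom_axioms_def)
  interpret q: group_hom F ?Q q by fact
  have qH: "q h = \<one>\<^bsub>?Q\<^esub>" if "h \<in> H" for h
    using F.coset_join2[of h H] that H.subgroup_axioms H.subset
    by (auto simp: q_def FactGroup_def)
  obtain D where D: "\<And>w. w \<in> carrier F \<Longrightarrow> trail F X ?Q F q w (D w)"
    using trail_exists[OF X F q] by metis
  then have D_fin: "\<And>w. w \<in> carrier F \<Longrightarrow> finite (D w)"
    and D_Q: "\<And>w. w \<in> carrier F \<Longrightarrow> D w \<subseteq> carrier ?Q"
    by (auto simp: trail_def)
  define B where "B = (\<Union>s \<in> S. D s)"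
  have SF: "S \<subseteq> carrier F" using assms(5) H.subset by blast
  have B: "finite B" "B \<subseteq> carrier ?Q"
    using assms(4) SF D_fin D_Q by (auto simp: B_def)
  have XF: "X \<subseteq> carrier F" using X by (simp add: free_basis_def)
  obtain \<psi> where \<psi>: "crossed_hom F ?Q F q \<psi>"
    and \<psi>X: "\<And>x v. x \<in> X \<Longrightarrow> v \<in> carrier ?Q \<Longrightarrow> \<psi> x v = (if v \<in> B then \<one>\<^bsub>F\<^esub> else x)"
    using crossed_hom_extends[OF X F q, of "\<lambda>x v. if v \<in> B then \<one>\<^bsub>F\<^esub> else x"] XF
    by (metis F.one_closed subsetD)
  \<comment> \<open>The normal subgroup of \<open>H\<close> by which the normal closure of \<open>S\<close> is bounded from above.\<close>
  let ?N = "{h \<in> H. \<psi> h \<one>\<^bsub>?Q\<^esub> = \<one>\<^bsub>F\<^esub>}"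
  have "S \<subseteq> ?N"
  proof
    fix s assume s: "s \<in> S"
    have triv: "(\<lambda>u. \<one>\<^bsub>F\<^esub>) \<in> hom F F" by (intro homI) auto
    have "\<psi> x (d \<otimes>\<^bsub>?Q\<^esub> \<one>\<^bsub>?Q\<^esub>) = \<one>\<^bsub>F\<^esub>" if "d \<in> D s" "x \<in> X" for d x
    proof -
      have "d \<in> B" using that s by (auto simp: B_def)
      then show ?thesis using B \<psi>X that by (metis Q.r_one subsetD)
    qed
    then have "\<psi> s \<one>\<^bsub>?Q\<^esub> = \<one>\<^bsub>F\<^esub>"
      using trail_agree[OF D \<psi> triv Q.one_closed, of s] s SF by blast
    then show "s \<in> ?N" using s assms(5) by blast
  qed
  then have "normal_closure (F\<lparr>carrier := H\<rparr>) S \<subseteq> ?N"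
    using crossed_hom_kernel_normal[OF F q \<psi> H.subgroup_axioms qH] normal_closure_least by blast
  then have KN: "K \<subseteq> ?N" using K by blast
  have "r = \<one>\<^bsub>F\<^esub>" if r: "r \<in> K" for r
  proof -
    have rF: "r \<in> carrier F" using r K.subset by blast
    obtain v where v: "v \<in> carrier ?Q" "\<And>d. d \<in> D r \<Longrightarrow> d \<otimes>\<^bsub>?Q\<^esub> v \<notin> B"
      using Q.translate_disjoint[OF assms(3) D_fin[OF rF] B(1) D_Q[OF rF] B(2)] by blast
    obtain f where f: "f \<in> carrier F" and qf: "q f = v"
      using v(1) by (auto simp: FactGroup_def RCOSETS_def q_def)
    have ident: "(\<lambda>u. u) \<in> hom F F" by (intro homI) auto
    have "\<psi> x (d \<otimes>\<^bsub>?Q\<^esub> v) = x" if "d \<in> D r" "x \<in> X" for d x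
      using \<psi>X[OF that(2), of "d \<otimes>\<^bsub>?Q\<^esub> v"] that v D_Q[OF rF] by (metis Q.m_closed subsetD)
    then have \<psi>r: "\<psi> r v = r"
      by (rule trail_agree[OF D[OF rF] \<psi> ident v(1)])
    define n where "n = inv\<^bsub>F\<^esub> f \<otimes>\<^bsub>F\<^esub> r \<otimes>\<^bsub>F\<^esub> f"
    have "n \<in> K" using K.inv_op_closed1[OF f r] by (simp add: n_def)
    then have n: "n \<in> carrier F" "q n = \<one>\<^bsub>?Q\<^esub>" "\<psi> n \<one>\<^bsub>?Q\<^esub> = \<one>\<^bsub>F\<^esub>"
      using KN qH K.subset by auto
    have \<psi>f: "\<psi> f \<one>\<^bsub>?Q\<^esub> \<in> carrier F" by (rule crossed_hom_closed[OF \<psi> f Q.one_closed])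
    have "r \<otimes>\<^bsub>F\<^esub> \<psi> f \<one>\<^bsub>?Q\<^esub> = \<psi> (r \<otimes>\<^bsub>F\<^esub> f) \<one>\<^bsub>?Q\<^esub>"
      using crossed_hom_mult[OF \<psi> rF f Q.one_closed] by (simp only: qf Q.r_one[OF v(1)] \<psi>r)
    also have "r \<otimes>\<^bsub>F\<^esub> f = f \<otimes>\<^bsub>F\<^esub> n"
      using f rF by (simp add: n_def F.m_assoc[symmetric])
    also have "\<psi> (f \<otimes>\<^bsub>F\<^esub> n) \<one>\<^bsub>?Q\<^esub> = \<psi> f \<one>\<^bsub>?Q\<^esub>"
      using crossed_hom_mult[OF \<psi> f n(1) Q.one_closed]
      by (simp only: n Q.r_one[OF Q.one_closed] F.r_one[OF \<psi>f])
    finally show ?thesis using rF \<psi>f F.l_cancel_one[OF \<psi>f rF] by simp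
  qed
  then show "K = {\<one>\<^bsub>F\<^esub>}" using K.one_closed by blast
qed

end
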